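(* For any $r\in(0,1]$, the set $\mathbb{K}_d(r)$ is compact in $\mathbb{X}_d$.
   Context: A convex domain in $\mathbb{C}^d$ is $\mathbb{C}$-properly convex if it contains no entire complex affine line. $\mathbb{X}_d$ is the set of all non-empty $\mathbb{C}$-properly convex domains in $\mathbb{C}^d$, with the local Hausdorff topology: $\Omega_n\to\Omega$ in $\mathbb{X}_d$ if there is $R_0\ge0$ such that for all $R\ge R_0$ the Hausdorff distance between $\overline{\Omega}_n\cap\overline{B(0;R)}$ and $\overline{\Omega}\cap\overline{B(0;R)}$ tends to $0$, where $B(0;R)$ is the Euclidean ball (the Hausdorff distance between the empty set and a non-empty set is $\infty$). With $e_1,\dots,e_d$ the standard basis of $\mathbb{C}^d$ and $\mathbb{D}\subset\mathbb{C}$ the open unit disk, for $r\in(0,1]$ the set $\mathbb{K}_d(r)\subset\mathbb{X}_d$ consists of the $\mathbb{C}$-properly convex domains $\Omega\subset\mathbb{C}^d$ such that (i) $r\mathbb{D}\cdot e_1\subset\Omega$ and $\mathbb{D}\cdot e_j\subset\Omega$ for $j=2,\dots,d$; and (ii) for every $j=1,\dots,d$, $e_j\in\partial\Omega$ and $(e_j+\mathrm{Span}_{\mathbb{C}}\{e_{j+1},\dots,e_d\})\cap\Omega=\emptyset$. *)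

theory Defs
  imports "HOL-Analysis.Analysis"
begin

definition complex_affine_line :: "(complex ^ 'n) set \<Rightarrow> bool" where
  "complex_affine_line L \<longleftrightarrow> (\<exists>a v. v \<noteq> 0 \<and> L = range (\<lambda>z. a + z *s v))"

(* A domain is a non-empty connected open set; connectedness is implied by convexity. *)
definition C_properly_convex_domains :: "(complex ^ 'n) set set" where
  "C_properly_convex_domains =
     {\<Omega>. open \<Omega> \<and> \<Omega> \<noteq> {} \<and> convex \<Omega> \<and> (\<forall>L. complex_affine_line L \<longrightarrow> \<not> L \<subseteq> \<Omega>)}"

(* In ennreal, SUP over the empty set is 0 and INF over the empty set is \<infinity>, so the distance
   between the empty set and a non-empty set is \<infinity>. *)
definition hausdorff_distance :: "'a::metric_space set \<Rightarrow> 'a set \<Rightarrow> ennreal" where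
  "hausdorff_distance A B =
     max (SUP x\<in>A. INF y\<in>B. ennreal (dist x y)) (SUP y\<in>B. INF x\<in>A. ennreal (dist x y))"

definition local_hausdorff_tendsto ::
    "(nat \<Rightarrow> 'a::real_normed_vector set) \<Rightarrow> 'a set \<Rightarrow> bool" where
  "local_hausdorff_tendsto W \<Omega> \<longleftrightarrow>
     (\<exists>R\<^sub>0\<ge>0. \<forall>R\<ge>R\<^sub>0.
        (\<lambda>n. hausdorff_distance (closure (W n) \<inter> cball 0 R) (closure \<Omega> \<inter> cball 0 R))
          \<longlonglongrightarrow> 0)"

(* The topology determined by the convergence of sequences: a set U is open iff every sequence
   converging to a point of U is eventually in U. *)
definition local_hausdorff_open :: "(complex ^ 'n) set set \<Rightarrow> bool" where
  "local_hausdorff_open U \<longleftrightarrow>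
     U \<subseteq> C_properly_convex_domains \<and>
     (\<forall>\<Omega>\<in>U. \<forall>W. range W \<subseteq> C_properly_convex_domains \<and> local_hausdorff_tendsto W \<Omega>
        \<longrightarrow> (\<forall>\<^sub>F n in sequentially. W n \<in> U))"

definition local_hausdorff_topology :: "(complex ^ 'n) set topology" where
  "local_hausdorff_topology = topology local_hausdorff_open"

lemma istopology_local_hausdorff_open:
  "istopology (local_hausdorff_open :: (complex ^ 'n) set set \<Rightarrow> bool)"
proof -
  have "local_hausdorff_open (S \<inter> T)"
    if "local_hausdorff_open S" "local_hausdorff_open T" for S T :: "(complex ^ 'n) set set"
    using that unfolding local_hausdorff_open_def by (auto simp: eventually_conj_iff)
  moreover have "local_hausdorff_open (\<Union>\<K>)"
    if \<K>: "\<forall>K\<in>\<K>. local_hausdorff_open K" for \<K> :: "(complex ^ 'n) set set set"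
    unfolding local_hausdorff_open_def
  proof (intro conjI ballI allI impI)
    show "\<Union>\<K> \<subseteq> C_properly_convex_domains"
      using \<K> unfolding local_hausdorff_open_def by blast
  next
    fix \<Omega> and W :: "nat \<Rightarrow> (complex ^ 'n) set"
    assume "\<Omega> \<in> \<Union>\<K>"
      and W: "range W \<subseteq> C_properly_convex_domains \<and> local_hausdorff_tendsto W \<Omega>"
    then obtain K where K: "K \<in> \<K>" "\<Omega> \<in> K" by blast
    with \<K> W have "\<forall>\<^sub>F n in sequentially. W n \<in> K"
      unfolding local_hausdorff_open_def by blast
    then show "\<forall>\<^sub>F n in sequentially. W n \<in> \<Union>\<K>"
      by (rule eventually_mono) (use K in blast)
  qed
  ultimately show ?thesis
    unfolding istopology_def by blast
qed

lemma openin_local_hausdorff_topology: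
  "openin local_hausdorff_topology U \<longleftrightarrow> local_hausdorff_open U"
  unfolding local_hausdorff_topology_def
  by (simp add: topology_inverse'[OF istopology_local_hausdorff_open])

lemma topspace_local_hausdorff_topology:
  "topspace local_hausdorff_topology = C_properly_convex_domains"
proof (rule subset_antisym)
  show "topspace local_hausdorff_topology \<subseteq> C_properly_convex_domains"
    using openin_topspace[of local_hausdorff_topology]
    unfolding openin_local_hausdorff_topology local_hausdorff_open_def by blast
  show "C_properly_convex_domains \<subseteq> topspace local_hausdorff_topology"
    by (rule openin_subset)
       (auto simp: openin_local_hausdorff_topology local_hausdorff_open_def image_subset_iff)
qed

(* The coordinates of \<complex>^d are indexed by a finite linearly ordered type with d elements; the basis
   vector e_j is axis j 1, the first index is Min UNIV, and vec.span is the complex span. *)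
definition normalized_domains :: "real \<Rightarrow> (complex ^ 'n::{finite,linorder}) set set" where
  "normalized_domains r =
     {\<Omega> \<in> C_properly_convex_domains.
        (\<lambda>z. z *s axis (Min UNIV) 1) ` ball 0 r \<subseteq> \<Omega> \<and>
        (\<forall>j. j \<noteq> Min UNIV \<longrightarrow> (\<lambda>z. z *s axis j 1) ` ball 0 1 \<subseteq> \<Omega>) \<and>
        (\<forall>j. axis j 1 \<in> frontier \<Omega> \<and>
             (\<lambda>v. axis j 1 + v) ` vec.span {axis k 1 | k. j < k} \<inter> \<Omega> = {})}"

end

theory Submission
  imports Defs
begin

text \<open>
  A normalized domain \<open>\<Omega>\<close> is encoded by the values of its distance function \<open>infdist \<cdot> \<Omega>\<close> at a
  countable dense set of points. All normalized domains contain the origin, so these values lie in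
  a compact product of intervals. Distance functions are 1-Lipschitz, so a limit of codes gives a
  locally uniform limit \<open>g\<close> of distance functions. The zero set of \<open>g\<close> is closed and convex with
  distance function \<open>g\<close>; its interior contains the convex hull of the normalizing discs, and each of
  its interior points eventually lies in the approximating domains, so the interior is again
  normalized. Hence the set of codes is compact. Decoding turns convergence of codes into local
  Hausdorff convergence, so it is continuous and its image is compact.

  The limit contains no complex line: otherwise, by convexity, it would contain the complex span of
  some \<open>v \<noteq> 0\<close>, and if \<open>j\<close> is the first index with \<open>v\<^sub>j \<noteq> 0\<close>, the multiple of \<open>v\<close> with \<open>j\<close>-th
  coordinate 1 lies in the forbidden slice through \<open>e\<^sub>j\<close>.
\<close>

section \<open>Limits of distance functions\<close>

lemma infdist_closure: "infdist x (closure S) = infdist x S"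
  by (simp add: infdist_eq_setdist)

lemma infdist_limit_lipschitz:
  assumes lim: "\<And>x. (\<lambda>n. infdist x (W n)) \<longlonglongrightarrow> g x"
  shows "\<bar>g x - g y\<bar> \<le> dist x y"
proof (rule LIMSEQ_le_const2)
  show "(\<lambda>n. \<bar>infdist x (W n) - infdist y (W n)\<bar>) \<longlonglongrightarrow> \<bar>g x - g y\<bar>"
    by (intro tendsto_intros lim)
qed (use infdist_triangle_abs in blast)

text \<open>All the functions \<open>infdist \<cdot> (W n)\<close> are 1-Lipschitz, so passing from
  \<open>x\<close> to a nearby point of \<open>D\<close> costs less than \<open>e / 4\<close>
  uniformly in \<open>n\<close>. The values at \<open>x\<close> therefore form a Cauchy
  sequence.\<close>

lemma infdist_pointwise_limit_of_dense:
  fixes W :: "nat \<Rightarrow> 'a::metric_space set"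
  assumes dense: "closure D = UNIV"
    and lim: "\<And>d. d \<in> D \<Longrightarrow> (\<lambda>n. infdist d (W n)) \<longlonglongrightarrow> l d"
  obtains g where "\<And>x. (\<lambda>n. infdist x (W n)) \<longlonglongrightarrow> g x"
proof -
  have "convergent (\<lambda>n. infdist x (W n))" for x
  proof (rule real_Cauchy_convergent, rule metric_CauchyI)
    fix e :: real assume "e > 0"
    then obtain d where d: "d \<in> D" "dist d x < e / 4"
      using dense closure_approachable[of x D] by (metis UNIV_I zero_less_divide_iff zero_less_numeral)
    obtain N where N: "\<And>m n. m \<ge> N \<Longrightarrow> n \<ge> N \<Longrightarrow> dist (infdist d (W m)) (infdist d (W n)) < e / 4"
      using metric_CauchyD[OF LIMSEQ_imp_Cauchy[OF lim[OF d(1)]], of "e / 4"] \<open>e > 0\<close> by auto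
    have "dist (infdist x (W m)) (infdist x (W n)) < e" if "m \<ge> N" "n \<ge> N" for m n
      using N[OF that] d(2) infdist_triangle_abs[of d "W m" x] infdist_triangle_abs[of d "W n" x]
      unfolding dist_real_def by linarith
    then show "\<exists>N. \<forall>m\<ge>N. \<forall>n\<ge>N. dist (infdist x (W m)) (infdist x (W n)) < e"
      by blast
  qed
  then show thesis
    using that unfolding convergent_def by metis
qed

text \<open>Pointwise convergence on a finite \<open>e / 4\<close>-net spreads to all of
  \<open>S\<close>, since the distance functions and their limit share the Lipschitz constant
  1.\<close>

lemma infdist_limit_uniform_on_compact:
  fixes W :: "nat \<Rightarrow> 'a::metric_space set"
  assumes lim: "\<And>x. (\<lambda>n. infdist x (W n)) \<longlonglongrightarrow> g x" and "compact S" "e > 0"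
  shows "\<forall>\<^sub>F n in sequentially. \<forall>x\<in>S. \<bar>infdist x (W n) - g x\<bar> < e"
proof -
  have "e / 4 > 0"
    using \<open>e > 0\<close> by simp
  then obtain k where k: "finite k" "S \<subseteq> (\<Union>x\<in>k. ball x (e / 4))"
    using \<open>compact S\<close> unfolding compact_eq_totally_bounded by metis
  have "\<forall>\<^sub>F n in sequentially. \<bar>infdist y (W n) - g y\<bar> < e / 4" for y
    using tendstoD[OF lim[of y], of "e / 4"] \<open>e > 0\<close> by (simp add: dist_real_def)
  then have "\<forall>\<^sub>F n in sequentially. \<forall>y\<in>k. \<bar>infdist y (W n) - g y\<bar> < e / 4"
    using k(1) by (simp add: eventually_ball_finite)
  then show ?thesis
  proof eventually_elim
    case (elim n)
    show ?case
    proof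
      fix x assume "x \<in> S"
      then obtain y where y: "y \<in> k" "dist y x < e / 4"
        using k(2) by auto
      then show "\<bar>infdist x (W n) - g x\<bar> < e"
        using bspec[OF elim y(1)] infdist_triangle_abs[of y "W n" x] infdist_limit_lipschitz[OF lim, of y x]
        by linarith
    qed
  qed
qed

text \<open>Points of \<open>closure (W n)\<close> nearest to \<open>x\<close> have a limit point
  \<open>b\<close>, which is a zero of \<open>g\<close> at distance exactly \<open>g x\<close> from
  \<open>x\<close>. No zero is closer, because \<open>g\<close> is 1-Lipschitz.\<close>

lemma infdist_limit_eq_infdist_zero_set:
  fixes W :: "nat \<Rightarrow> 'a::heine_borel set"
  assumes ne: "\<And>n. W n \<noteq> {}"
    and lim: "\<And>x. (\<lambda>n. infdist x (W n)) \<longlonglongrightarrow> g x"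
  shows "infdist x {y. g y = 0} = g x"
proof -
  have "\<exists>y\<in>closure (W n). infdist x (W n) = dist x y" for n
    using infdist_attains_inf[of "closure (W n)" x] ne[of n] infdist_closure[of x "W n"] closed_closure
    by (metis closure_eq_empty)
  then obtain y where y: "\<And>n. y n \<in> closure (W n)" "\<And>n. infdist x (W n) = dist x (y n)"
    by metis
  \<comment> \<open>The distances \<open>dist x (y n)\<close> form a convergent sequence, so the
    nearest points cannot escape to infinity.\<close>
  have "bounded (range y)"
  proof -
    obtain B where "\<And>n. norm (infdist x (W n)) \<le> B"
      using convergent_imp_bounded[OF lim[of x]] by (auto simp: bounded_iff)
    then show ?thesis
      unfolding bounded_def using y(2) by (intro exI[of _ x] exI[of _ B]) auto
  qed
  then obtain b s where s: "strict_mono s" and b: "(y \<circ> s) \<longlonglongrightarrow> b"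
    using bounded_imp_convergent_subsequence[of y] by blast
  have lims: "(\<lambda>n. infdist z (W (s n))) \<longlonglongrightarrow> g z" for z
    using LIMSEQ_subseq_LIMSEQ[OF lim s] by (simp add: o_def)
  have "g b \<le> 0"
  proof (rule LIMSEQ_le[OF lims[of b]])
    show "(\<lambda>n. dist b (y (s n))) \<longlonglongrightarrow> 0"
      using tendsto_dist[OF tendsto_const b, of b] by (simp add: o_def)
    have "infdist b (W (s n)) \<le> dist b (y (s n))" for n
      using infdist_le[OF y(1)[of "s n"], of b] infdist_closure[of b "W (s n)"] by metis
    then show "\<exists>N. \<forall>n\<ge>N. infdist b (W (s n)) \<le> dist b (y (s n))" by blast
  qed
  moreover have "g b \<ge> 0"
    by (rule LIMSEQ_le_const[OF lim]) (simp add: infdist_nonneg)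
  ultimately have gb: "g b = 0" by simp
  have "dist x b = g x"
  proof (rule LIMSEQ_unique)
    show "(\<lambda>n. dist x (y (s n))) \<longlonglongrightarrow> dist x b"
      using tendsto_dist[OF tendsto_const b, of x] by (simp add: o_def)
    show "(\<lambda>n. dist x (y (s n))) \<longlonglongrightarrow> g x"
      using lims[of x] y(2) by simp
  qed
  then have "infdist x {y. g y = 0} \<le> g x"
    using infdist_le[of b "{y. g y = 0}" x] gb by simp
  moreover have "g x \<le> infdist x {y. g y = 0}"
  proof -
    have "g x \<le> dist x y" if "g y = 0" for y
      using infdist_limit_lipschitz[OF lim, of x y] that by simp
    then show ?thesis
      using gb by (auto simp: infdist_def intro!: cINF_greatest)
  qed
  ultimately show ?thesis by simp
qed

text \<open>Nearly optimal points for \<open>x\<close> and \<open>y\<close> are combined with the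
  weights \<open>u\<close> and \<open>v\<close>. The slack \<open>e\<close> replaces nearest points,
  which may not exist because \<open>S\<close> need not be closed.\<close>

lemma infdist_convex:
  fixes S :: "'a::real_normed_vector set"
  assumes "convex S" "S \<noteq> {}" "u \<ge> 0" "v \<ge> 0" "u + v = 1"
  shows "infdist (u *\<^sub>R x + v *\<^sub>R y) S \<le> u * infdist x S + v * infdist y S"
proof (rule field_le_epsilon)
  fix e :: real assume "e > 0"
  have *: "\<exists>a\<in>S. dist z a < infdist z S + e" for z
    using assms(2) \<open>e > 0\<close> cINF_less_iff[of S "dist z" "infdist z S + e"]
    by (simp add: infdist_notempty)
  obtain a b where a: "a \<in> S" "dist x a < infdist x S + e" and b: "b \<in> S" "dist y b < infdist y S + e"
    using *[of x] *[of y] by blast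
  have "u *\<^sub>R a + v *\<^sub>R b \<in> S"
    using assms a b by (simp add: convexD)
  then have "infdist (u *\<^sub>R x + v *\<^sub>R y) S \<le> dist (u *\<^sub>R x + v *\<^sub>R y) (u *\<^sub>R a + v *\<^sub>R b)"
    by (rule infdist_le)
  also have "\<dots> = norm (u *\<^sub>R (x - a) + v *\<^sub>R (y - b))"
    by (simp add: dist_norm algebra_simps)
  also have "\<dots> \<le> u * dist x a + v * dist y b"
    using norm_triangle_ineq[of "u *\<^sub>R (x - a)" "v *\<^sub>R (y - b)"] assms by (simp add: dist_norm)
  also have "\<dots> \<le> u * (infdist x S + e) + v * (infdist y S + e)"
    using a b assms by (intro add_mono mult_left_mono) auto
  also have "\<dots> = u * infdist x S + v * infdist y S + (u + v) * e"
    by (simp add: algebra_simps)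
  finally show "infdist (u *\<^sub>R x + v *\<^sub>R y) S \<le> u * infdist x S + v * infdist y S + e"
    using assms by simp
qed

lemma convex_infdist_limit_zero_set:
  fixes W :: "nat \<Rightarrow> 'a::real_normed_vector set"
  assumes "\<And>n. W n \<noteq> {}" "\<And>n. convex (W n)"
    and lim: "\<And>x. (\<lambda>n. infdist x (W n)) \<longlonglongrightarrow> g x"
  shows "convex {x. g x = 0}"
proof (rule convexI)
  fix x y :: 'a and u v :: real
  assume *: "x \<in> {x. g x = 0}" "y \<in> {x. g x = 0}" "0 \<le> u" "0 \<le> v" "u + v = 1"
  have "g (u *\<^sub>R x + v *\<^sub>R y) \<le> u * g x + v * g y"
  proof (rule LIMSEQ_le[OF lim])
    show "(\<lambda>n. u * infdist x (W n) + v * infdist y (W n)) \<longlonglongrightarrow> u * g x + v * g y"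
      by (intro tendsto_intros lim)
    show "\<exists>N. \<forall>n\<ge>N. infdist (u *\<^sub>R x + v *\<^sub>R y) (W n) \<le> u * infdist x (W n) + v * infdist y (W n)"
      using infdist_convex[OF assms(2,1) *(3-5)] by simp
  qed
  moreover have "g (u *\<^sub>R x + v *\<^sub>R y) \<ge> 0"
    by (rule LIMSEQ_le_const[OF lim]) (simp add: infdist_nonneg)
  ultimately show "u *\<^sub>R x + v *\<^sub>R y \<in> {x. g x = 0}"
    using * by simp
qed

text \<open>The witness lies at distance \<open>e\<close> from \<open>x\<close> along the normal of a separating hyperplane.\<close>
lemma exists_far_point_of_not_mem_convex:
  fixes S :: "'a::euclidean_space set"
  assumes "convex S" "S \<noteq> {}" "x \<notin> S" "e > 0"
  shows "\<exists>y\<in>cball x e. infdist y S \<ge> e"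
proof -
  obtain a b where a: "a \<noteq> 0" "a \<bullet> x \<ge> b" "\<And>y. y \<in> S \<Longrightarrow> a \<bullet> y \<le> b"
    using separating_hyperplane_sets[of S "{x}"] assms by auto
  define y where "y = x + (e / norm a) *\<^sub>R a"
  have "e \<le> dist y z" if "z \<in> S" for z
  proof -
    have "e * norm a = a \<bullet> (y - x)"
      using a(1) by (simp add: y_def dot_square_norm power2_eq_square)
    also have "\<dots> \<le> a \<bullet> (y - z)"
      using a(2) a(3)[OF that] by (simp add: inner_diff_right)
    also have "\<dots> \<le> norm a * dist y z"
      by (simp add: dist_norm norm_cauchy_schwarz)
    finally show ?thesis
      using a(1) by (simp add: mult.commute)
  qed
  then have "infdist y S \<ge> e"
    using assms(2) by (simp add: infdist_def cINF_greatest)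
  moreover have "y \<in> cball x e"
    using a(1) assms(4) by (simp add: y_def dist_norm)
  ultimately show ?thesis by blast
qed

text \<open>If a convex \<open>W n\<close> missed \<open>x\<close>, some point within
  \<open>e\<close> of \<open>x\<close> would have distance at least \<open>e\<close> from
  \<open>W n\<close>. This contradicts uniform convergence to \<open>g = 0\<close> on a small
  ball.\<close>

lemma interior_infdist_limit_zero_set_eventually_mem:
  fixes W :: "nat \<Rightarrow> 'a::euclidean_space set"
  assumes "\<And>n. W n \<noteq> {}" "\<And>n. convex (W n)"
    and lim: "\<And>x. (\<lambda>n. infdist x (W n)) \<longlonglongrightarrow> g x"
    and x: "x \<in> interior {x. g x = 0}"
  shows "\<forall>\<^sub>F n in sequentially. x \<in> W n"
proof -
  obtain e where e: "e > 0" "cball x e \<subseteq> {x. g x = 0}"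
    using x by (auto simp: mem_interior_cball)
  have "\<forall>\<^sub>F n in sequentially. \<forall>y\<in>cball x e. \<bar>infdist y (W n) - g y\<bar> < e"
    using infdist_limit_uniform_on_compact[OF lim compact_cball e(1)] .
  then show ?thesis
  proof eventually_elim
    case (elim n)
    show ?case
    proof (rule ccontr)
      assume "x \<notin> W n"
      then obtain y where "y \<in> cball x e" "infdist y (W n) \<ge> e"
        using exists_far_point_of_not_mem_convex[of "W n" x e] assms(1,2) e(1) by blast
      then show False
        using elim e(2) by fastforce
    qed
  qed
qed

section \<open>Local Hausdorff convergence from convergence of distance functions\<close>

text \<open>This handles the truncation by balls in the local Hausdorff distance. Convexity and
  \<open>0 \<in> S\<close> allow radial shrinking by \<open>t\<close>, which takes norm
  \<open>R + e\<close> to \<open>R\<close> and moves the nearest point by at most \<open>e\<close>;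
  hence the factor 2.\<close>

lemma exists_near_point_in_cball:
  fixes S :: "'a::euclidean_space set"
  assumes "convex S" "0 \<in> S" "norm x \<le> R" "infdist x S \<le> e" "e > 0"
  shows "\<exists>y\<in>closure S \<inter> cball 0 R. dist x y \<le> 2 * e"
proof -
  obtain z where z: "z \<in> closure S" "dist x z \<le> e"
    using infdist_attains_inf[of "closure S" x] assms infdist_closure[of x S] closed_closure
    by (metis closure_eq_empty empty_iff)
  have R: "R \<ge> 0"
    using assms(3) norm_ge_zero order_trans by blast
  have nz: "norm z \<le> R + e"
    using z(2) assms(3) norm_triangle_sub[of z x] by (simp add: dist_norm norm_minus_commute)
  \<comment> \<open>The nearest point may leave the ball of radius \<open>R\<close>; shrink it towards \<open>0\<close>.\<close>
  define t where "t = R / (R + e)"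
  have t: "0 \<le> t" "t \<le> 1" "t * (R + e) = R" "(1 - t) * (R + e) = e"
    using R assms(5) by (auto simp: t_def field_simps)
  have "t *\<^sub>R z + (1 - t) *\<^sub>R 0 \<in> closure S"
    using convex_closure[OF assms(1)] z(1) t closure_subset[of S] assms(2) by (intro convexD) auto
  moreover have "norm (t *\<^sub>R z) \<le> R"
    using mult_left_mono[OF nz t(1)] t by simp
  moreover have "dist x (t *\<^sub>R z) \<le> 2 * e"
  proof -
    have "dist z (t *\<^sub>R z) = norm ((1 - t) *\<^sub>R z)"
      by (simp add: dist_norm algebra_simps)
    also have "\<dots> \<le> e"
      using mult_left_mono[OF nz, of "1 - t"] t by simp
    finally show ?thesis
      using z(2) dist_triangle[of x "t *\<^sub>R z" z] by simp
  qed
  ultimately show ?thesis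
    by auto
qed

lemma hausdorff_distance_le:
  assumes "\<And>x. x \<in> A \<Longrightarrow> \<exists>y\<in>B. dist x y \<le> e" "\<And>y. y \<in> B \<Longrightarrow> \<exists>x\<in>A. dist x y \<le> e"
  shows "hausdorff_distance A B \<le> ennreal e"
  unfolding hausdorff_distance_def
proof (intro max.boundedI SUP_least)
  fix x assume "x \<in> A"
  then obtain y where "y \<in> B" "dist x y \<le> e"
    using assms(1) by blast
  then show "(INF y\<in>B. ennreal (dist x y)) \<le> ennreal e"
    by (intro INF_lower2[of y] ennreal_leI)
next
  fix y assume "y \<in> B"
  then obtain x where "x \<in> A" "dist x y \<le> e"
    using assms(2) by blast
  then show "(INF x\<in>A. ennreal (dist x y)) \<le> ennreal e"
    by (intro INF_lower2[of x] ennreal_leI)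
qed

lemma local_hausdorff_tendsto_of_infdist:
  fixes W :: "nat \<Rightarrow> 'a::euclidean_space set"
  assumes W: "\<And>n. convex (W n)" "\<And>n. 0 \<in> W n" and S: "convex S" "0 \<in> S"
    and lim: "\<And>x. (\<lambda>n. infdist x (W n)) \<longlonglongrightarrow> infdist x S"
  shows "local_hausdorff_tendsto W S"
  unfolding local_hausdorff_tendsto_def
\<comment> \<open>The threshold 0 works: every set contains 0, so radial shrinking towards 0 is
  available in each closed ball of radius \<open>R \<ge> 0\<close>.\<close>
proof (intro exI[of _ 0] conjI allI impI order_tendstoI)
  fix R :: real and a :: ennreal assume "R \<ge> 0" "0 < a"
  then obtain b where b: "0 < b" "b < a"
    using dense by blast
  \<comment> \<open>The bound \<open>a\<close> may be infinite, but \<open>b < a\<close> is finite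
    and hence comes from a real number.\<close>
  then obtain e where e: "b = ennreal e" "e > 0"
    by (cases b) (auto simp: top_unique)
  \<comment> \<open>Half of \<open>e\<close> makes up for the factor 2 in
    \<open>exists_near_point_in_cball\<close>.\<close>
  have "\<forall>\<^sub>F n in sequentially. \<forall>x\<in>cball 0 R. \<bar>infdist x (W n) - infdist x S\<bar> < e / 2"
    using e(2) by (intro infdist_limit_uniform_on_compact[OF lim]) auto
  then show "\<forall>\<^sub>F n in sequentially.
      hausdorff_distance (closure (W n) \<inter> cball 0 R) (closure S \<inter> cball 0 R) < a"
  proof eventually_elim
    case (elim n)
    have "hausdorff_distance (closure (W n) \<inter> cball 0 R) (closure S \<inter> cball 0 R) \<le> ennreal e"
    proof (rule hausdorff_distance_le)
      fix x assume x: "x \<in> closure (W n) \<inter> cball 0 R"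
      then have "infdist x (W n) = 0"
        using in_closure_iff_infdist_zero W(2) by blast
      then show "\<exists>y\<in>closure S \<inter> cball 0 R. dist x y \<le> e"
        using exists_near_point_in_cball[OF S, of x R "e / 2"] bspec[OF elim, of x] x e(2) by simp
    next
      fix x assume x: "x \<in> closure S \<inter> cball 0 R"
      then have "infdist x S = 0"
        using in_closure_iff_infdist_zero S(2) by blast
      then show "\<exists>y\<in>closure (W n) \<inter> cball 0 R. dist y x \<le> e"
        using exists_near_point_in_cball[OF W, of x R n "e / 2"] bspec[OF elim, of x] x e(2)
        by (simp add: dist_commute)
    qed
    then show ?case
      using b e by order
  qed
qed auto

section \<open>Normalized domains\<close>

text \<open>The interior of the convex hull of the discs in the normalization.\<close>
definition weighted_cross_polytope :: "real \<Rightarrow> (complex ^ 'n::{finite,linorder}) set" where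
  "weighted_cross_polytope r = {x. (\<Sum>j\<in>UNIV. norm (x $ j) / (if j = Min UNIV then r else 1)) < 1}"

lemma open_weighted_cross_polytope:
  assumes "0 < r"
  shows "open (weighted_cross_polytope r)"
  unfolding weighted_cross_polytope_def
  using assms by (intro open_Collect_less continuous_intros) auto

lemma zero_mem_weighted_cross_polytope: "0 \<in> weighted_cross_polytope r"
  by (simp add: weighted_cross_polytope_def)

lemma weighted_norm_axis:
  "(\<Sum>i\<in>UNIV. norm ((z *s axis j 1 :: complex ^ 'n) $ i) / \<rho> i) = norm z / \<rho> j"
proof -
  have "(\<Sum>i\<in>UNIV. norm ((z *s axis j 1 :: complex ^ 'n) $ i) / \<rho> i)
      = (\<Sum>i\<in>UNIV. if i = j then norm z / \<rho> j else 0)"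
    by (rule sum.cong) (auto simp: axis_def)
  then show ?thesis by simp
qed

text \<open>Each point of the polytope is a convex combination of points of the discs, one for each
  coordinate axis.\<close>

lemma weighted_cross_polytope_subset:
  fixes \<Omega> :: "(complex ^ 'n::{finite,linorder}) set"
  assumes "0 < r" "convex \<Omega>"
    and first: "(\<lambda>z. z *s axis (Min UNIV) 1) ` ball 0 r \<subseteq> \<Omega>"
    and others: "\<And>j. j \<noteq> Min UNIV \<Longrightarrow> (\<lambda>z. z *s axis j 1) ` ball 0 1 \<subseteq> \<Omega>"
  shows "weighted_cross_polytope r \<subseteq> \<Omega>"
proof
  fix x :: "(complex, 'n) vec" assume "x \<in> weighted_cross_polytope r"
  define \<rho> where "\<rho> j = (if j = Min UNIV then r else 1)" for j :: 'n
  define s where "s = (\<Sum>j\<in>UNIV. norm (x $ j) / \<rho> j)"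
  \<comment> \<open>The slack \<open>1 - s\<close> is shared equally among the coordinates. The
    weights then sum to 1 and are positive, and each \<open>x $ j / w j\<close> lies strictly inside
    its open disc.\<close>
  define w where "w j = norm (x $ j) / \<rho> j + (1 - s) / CARD('n)" for j
  have \<rho>: "\<rho> j > 0" for j
    using \<open>0 < r\<close> by (simp add: \<rho>_def)
  have disc: "z *s axis j 1 \<in> \<Omega>" if "norm z < \<rho> j" for z j
    using first others[of j] that by (cases "j = Min UNIV") (auto simp: \<rho>_def)
  have "s < 1"
    using \<open>x \<in> _\<close> by (simp add: weighted_cross_polytope_def s_def \<rho>_def)
  then have w: "w j > 0" for j
    unfolding w_def using \<rho>[of j] by (intro add_nonneg_pos) auto
  have "(\<Sum>j\<in>UNIV. w j *\<^sub>R ((x $ j / of_real (w j)) *s axis j 1)) \<in> \<Omega>"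
  proof (rule convex_sum[OF _ \<open>convex \<Omega>\<close>])
    show "(\<Sum>j\<in>UNIV. w j) = 1"
      by (simp add: w_def sum.distrib s_def)
    fix j :: 'n
    have "norm (x $ j) / \<rho> j < w j"
      using \<open>s < 1\<close> by (simp add: w_def)
    then have "norm (x $ j / of_real (w j)) < \<rho> j"
      using w[of j] \<rho>[of j] by (simp add: norm_divide field_simps)
    then show "(x $ j / of_real (w j)) *s axis j 1 \<in> \<Omega>"
      by (rule disc)
  qed (use w less_imp_le in auto)
  moreover have "w j *\<^sub>R ((x $ j / of_real (w j)) *s axis j 1) = x $ j *s axis j 1" for j
    using w[of j] by (simp add: vec_eq_iff axis_def scaleR_conv_of_real[where 'a = complex])
  ultimately show "x \<in> \<Omega>"
    by (simp add: basis_expansion)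
qed

lemma span_axis_greater_eq:
  "vec.span {axis k (1::complex) | k. j < k} = {x :: complex ^ 'n::{finite,linorder}. \<forall>i. i \<le> j \<longrightarrow> x $ i = 0}"
proof (intro subset_antisym subsetI)
  fix x :: "(complex, 'n) vec" assume "x \<in> vec.span {axis k 1 | k. j < k}"
  moreover have "vec.subspace {x :: (complex, 'n) vec. \<forall>i. i \<le> j \<longrightarrow> x $ i = 0}"
    by (auto simp: vec.subspace_def)
  moreover have "{axis k 1 | k. j < k} \<subseteq> {x :: (complex, 'n) vec. \<forall>i. i \<le> j \<longrightarrow> x $ i = 0}"
    by (auto simp: axis_def)
  ultimately show "x \<in> {x. \<forall>i. i \<le> j \<longrightarrow> x $ i = 0}"
    using vec.span_minimal by blast
next
  fix x :: "(complex, 'n) vec" assume x: "x \<in> {x. \<forall>i. i \<le> j \<longrightarrow> x $ i = 0}"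
  have "(\<Sum>i\<in>UNIV. x $ i *s axis i 1) \<in> vec.span {axis k 1 | k. j < k}"
  proof (rule vec.span_sum)
    fix i :: 'n
    show "x $ i *s axis i 1 \<in> vec.span {axis k 1 | k. j < k}"
    proof (cases "i \<le> j")
      case True
      then show ?thesis using x by (simp add: vec.span_zero)
    next
      case False
      then show ?thesis by (intro vec.span_scale vec.span_base) auto
    qed
  qed
  then show "x \<in> vec.span {axis k 1 | k. j < k}"
    by (simp add: basis_expansion)
qed

text \<open>For \<open>0 < t < 1\<close>, the vector \<open>v\<close> is the convex combination,
  with weights \<open>1 - t\<close> and \<open>t\<close>, of
  \<open>- (t / (1 - t)) *\<^sub>R a\<close> and the point of the line with parameter
  \<open>1 / t\<close>. For small \<open>t\<close> the first point is close to 0.\<close>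

lemma complex_line_direction_mem:
  fixes \<Omega> :: "(complex ^ 'n) set"
  assumes "open \<Omega>" "convex \<Omega>" "0 \<in> \<Omega>" and line: "range (\<lambda>z. a + z *s v) \<subseteq> \<Omega>"
  shows "v \<in> \<Omega>"
proof -
  obtain e where e: "e > 0" "ball 0 e \<subseteq> \<Omega>"
    using assms open_contains_ball by blast
  have "((\<lambda>t. - (t / (1 - t)) *\<^sub>R a) \<longlongrightarrow> - (0 / (1 - 0)) *\<^sub>R a) (at_right (0::real))"
    by (intro tendsto_intros) auto
  then have "\<forall>\<^sub>F t in at_right (0::real). norm (- (t / (1 - t)) *\<^sub>R a) < e"
    using tendstoD[OF _ e(1)] by (force simp: dist_norm simp del: norm_scaleR)
  moreover have "\<forall>\<^sub>F t in at_right (0::real). 0 < t \<and> t < 1"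
    using eventually_at_right_real[of 0 1] by simp
  ultimately have "\<forall>\<^sub>F t in at_right (0::real). norm (- (t / (1 - t)) *\<^sub>R a) < e \<and> 0 < t \<and> t < 1"
    by eventually_elim auto
  then obtain t :: real where t: "norm (- (t / (1 - t)) *\<^sub>R a) < e" "0 < t" "t < 1"
    using eventually_happens'[OF trivial_limit_at_right_real[of 0]] by blast
  define p where "p = - (t / (1 - t)) *\<^sub>R a"
  have "p \<in> \<Omega>"
    using t(1) e(2) by (auto simp: p_def)
  moreover have "a + of_real (1 / t) *s v \<in> \<Omega>"
    using line by blast
  ultimately have "(1 - t) *\<^sub>R p + t *\<^sub>R (a + of_real (1 / t) *s v) \<in> \<Omega>"
    using assms(2) t by (intro convexD) auto
  moreover have "(1 - t) *\<^sub>R p = - t *\<^sub>R a"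
    using t by (simp add: p_def)
  moreover have "t *\<^sub>R (of_real (1 / t) *s v) = v"
    using t by (simp add: vec_eq_iff scaleR_conv_of_real[where 'a = complex])
  ultimately show ?thesis
    by (simp add: scaleR_add_right)
qed

text \<open>This form is suited to limits: the discs become one fixed open set, boundary points
  become points of the closure, and the absence of complex lines is recovered from the
  slices.\<close>

lemma mem_normalized_domains_iff:
  fixes \<Omega> :: "(complex ^ 'n::{finite,linorder}) set"
  assumes "0 < r"
  shows "\<Omega> \<in> normalized_domains r \<longleftrightarrow>
    open \<Omega> \<and> convex \<Omega> \<and> weighted_cross_polytope r \<subseteq> \<Omega> \<and>
    (\<forall>j. axis j 1 \<in> closure \<Omega> \<and>
         (\<lambda>v. axis j 1 + v) ` vec.span {axis k 1 | k. j < k} \<inter> \<Omega> = {})"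
    (is "_ \<longleftrightarrow> ?rhs")
proof
  assume "\<Omega> \<in> normalized_domains r"
  then have *: "\<Omega> \<in> C_properly_convex_domains"
    "(\<lambda>z. z *s axis (Min UNIV) 1) ` ball 0 r \<subseteq> \<Omega>"
    "\<And>j. j \<noteq> Min UNIV \<Longrightarrow> (\<lambda>z. z *s axis j 1) ` ball 0 1 \<subseteq> \<Omega>"
    "\<And>j. axis j 1 \<in> frontier \<Omega>"
    "\<And>j. (\<lambda>v. axis j 1 + v) ` vec.span {axis k 1 | k. j < k} \<inter> \<Omega> = {}"
    unfolding normalized_domains_def by blast+
  then show ?rhs
    using weighted_cross_polytope_subset[OF assms _ *(2,3)]
    by (auto simp: C_properly_convex_domains_def frontier_def)
next
  assume R: ?rhs
  then have slice: "\<And>j. (\<lambda>v. axis j 1 + v) ` vec.span {axis k 1 | k. j < k} \<inter> \<Omega> = {}"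
    by blast
  have zero: "0 \<in> \<Omega>"
    using R zero_mem_weighted_cross_polytope by blast
  have no_line: "\<not> range (\<lambda>z. a + z *s v) \<subseteq> \<Omega>" if "v \<noteq> 0" for a v
  proof
    assume line: "range (\<lambda>z. a + z *s v) \<subseteq> \<Omega>"
    define j where "j = Min {i. v $ i \<noteq> 0}"
    have "{i. v $ i \<noteq> 0} \<noteq> {}"
      using that by (auto simp: vec_eq_iff)
    then have j: "v $ j \<noteq> 0" "\<And>i. i < j \<Longrightarrow> v $ i = 0"
      using Min_in[of "{i. v $ i \<noteq> 0}"] Min_le[of "{i. v $ i \<noteq> 0}"]
      by (auto simp: j_def)
    define u where "u = inverse (v $ j) *s v"
    have "range (\<lambda>z. a + z *s u) \<subseteq> \<Omega>"
    proof (rule image_subsetI)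
      fix z
      have "a + z *s u = a + (z * inverse (v $ j)) *s v"
        by (simp add: u_def vector_smult_assoc)
      then show "a + z *s u \<in> \<Omega>"
        using line by auto
    qed
    then have "u \<in> \<Omega>"
      using complex_line_direction_mem R zero by blast
    moreover have "u - axis j 1 \<in> vec.span {axis k 1 | k. j < k}"
      unfolding span_axis_greater_eq using j by (auto simp: u_def axis_def le_less)
    then have "axis j 1 + (u - axis j 1) \<in> (\<lambda>v. axis j 1 + v) ` vec.span {axis k 1 | k. j < k}"
      by (rule imageI)
    ultimately show False
      using slice[of j] by auto
  qed
  \<comment> \<open>The span contains 0, so the slice condition excludes \<open>axis j 1\<close>
    itself. As \<open>\<Omega>\<close> is open, this turns membership in the closure into membership
    in the frontier.\<close>
  have "axis j 1 \<notin> \<Omega>" for j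
    using slice[of j] imageI[OF vec.span_zero[of "{axis k 1 | k. j < k}"], of "\<lambda>v. axis j 1 + v"]
    by auto
  moreover have "z *s axis j 1 \<in> \<Omega>"
    if "norm z < (if j = Min UNIV then r else 1)" for z j
  proof -
    have "z *s axis j 1 \<in> weighted_cross_polytope r"
      using that assms weighted_norm_axis[of z j "\<lambda>j. if j = Min UNIV then r else 1"]
      by (auto simp: weighted_cross_polytope_def split: if_splits)
    then show ?thesis
      using R by blast
  qed
  moreover have "\<Omega> \<in> C_properly_convex_domains"
    using R no_line zero unfolding C_properly_convex_domains_def complex_affine_line_def by blast
  ultimately show "\<Omega> \<in> normalized_domains r"
    using R unfolding normalized_domains_def
    by (auto simp: frontier_def interior_open image_subset_iff)
qed

text \<open>The limit domain is the interior of the zero set of \<open>g\<close>: openness is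
  restored while the distance function stays the same.\<close>

lemma normalized_domains_infdist_limit:
  fixes W :: "nat \<Rightarrow> (complex ^ 'n::{finite,linorder}) set"
  assumes "0 < r" and W: "\<And>n. W n \<in> normalized_domains r"
    and lim: "\<And>x. (\<lambda>n. infdist x (W n)) \<longlonglongrightarrow> g x"
  obtains \<Omega> where "\<Omega> \<in> normalized_domains r" "\<And>x. infdist x \<Omega> = g x"
proof -
  note W' = W[unfolded mem_normalized_domains_iff[OF assms(1)]]
  let ?H = "weighted_cross_polytope r :: ((complex, 'n) vec) set"
  define C where "C = {x. g x = 0}"
  have ne: "W n \<noteq> {}" and cv: "convex (W n)" for n
    using W'[of n] zero_mem_weighted_cross_polytope by blast+
  have C: "convex C" "\<And>x. infdist x C = g x"
    unfolding C_def
    using convex_infdist_limit_zero_set[OF ne cv lim] infdist_limit_eq_infdist_zero_set[OF ne lim] by auto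
  have in_C: "x \<in> C" if "\<And>n. x \<in> closure (W n)" for x
  proof -
    have "infdist x (W n) = 0" for n
      using in_closure_iff_infdist_zero[OF ne] that by blast
    then show ?thesis
      using lim[of x] LIMSEQ_unique[OF _ tendsto_const] by (auto simp: C_def)
  qed
  have H: "?H \<subseteq> interior C"
    using W' in_C closure_subset by (intro interior_maximal open_weighted_cross_polytope assms(1)) blast
  then have "interior C \<noteq> {}"
    using zero_mem_weighted_cross_polytope by blast
  \<comment> \<open>A convex set with non-empty interior has the same closure as its interior, so
    neither the points \<open>axis j 1\<close> nor the distances are lost.\<close>
  then have cl: "closure (interior C) = closure C"
    by (rule convex_closure_interior[OF C(1)])
  have "interior C \<in> normalized_domains r"
    unfolding mem_normalized_domains_iff[OF assms(1)]
  proof (intro conjI allI H open_interior convex_interior C(1))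
    fix j :: 'n
    show "axis j 1 \<in> closure (interior C)"
      unfolding cl using in_C W' closure_subset by blast
    \<comment> \<open>An interior point in a forbidden slice would already lie in some
      \<open>W n\<close>, which avoids that slice.\<close>
    have "\<exists>n. x \<in> W n" if "x \<in> interior C" for x
      using interior_infdist_limit_zero_set_eventually_mem[OF ne cv lim] that
      unfolding C_def eventually_sequentially by blast
    then show "(\<lambda>v. axis j 1 + v) ` vec.span {axis k 1 | k. j < k} \<inter> interior C = {}"
      using W' by blast
  qed
  moreover have "infdist x (interior C) = g x" for x
    using C(2) infdist_closure cl by metis
  ultimately show thesis
    using that by blast
qed

section \<open>Compactness\<close>

text \<open>Tychonoff's theorem, since the topology on functions is the product topology. The codes
  of normalized domains lie in such a box.\<close>

lemma compact_box_sequences: "compact {f :: nat \<Rightarrow> real. \<forall>i. f i \<in> {0..b i}}"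
proof -
  have "compactin (product_topology (\<lambda>i. euclidean) UNIV) (PiE UNIV (\<lambda>i. {0..b i}))"
    by (subst compactin_PiE) auto
  moreover have "PiE UNIV (\<lambda>i. {0..b i}) = {f :: nat \<Rightarrow> real. \<forall>i. f i \<in> {0..b i}}"
    by (auto simp: PiE_def Pi_def)
  ultimately show ?thesis
    by (simp add: euclidean_product_topology)
qed

lemma tendsto_fun_apply:
  fixes f :: "nat \<Rightarrow> nat \<Rightarrow> real"
  assumes "f \<longlonglongrightarrow> l"
  shows "(\<lambda>n. f n i) \<longlonglongrightarrow> l i"
  using continuous_on_tendsto_compose[OF continuous_on_product_coordinates assms, of i] by simp

theorem proposition4p2:
  fixes r :: real
  assumes "0 < r" and "r \<le> 1"
  shows "compactin local_hausdorff_topology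
           (normalized_domains r :: (complex ^ 'n::{finite,linorder}) set set)"
proof -
  let ?K = "normalized_domains r :: ((complex, 'n) vec) set set"
  obtain D :: "((complex, 'n) vec) set" where D: "countable D" "\<And>X. open X \<Longrightarrow> X \<noteq> {} \<Longrightarrow> \<exists>d\<in>D. d \<in> X"
    using countable_dense_setE by blast
  then have "D \<noteq> {}"
    by blast
  have dense: "closure D = UNIV"
    using D(2)[of "- closure D"] closure_subset[of D] by fastforce
  define q where "q = from_nat_into D"
  have range_q: "range q = D"
    unfolding q_def by (rule range_from_nat_into[OF \<open>D \<noteq> {}\<close> D(1)])
  define F where "F \<Omega> i = infdist (q i) \<Omega>" for \<Omega> i
  note K = mem_normalized_domains_iff[OF assms(1), THEN iffD1]
  have zero: "0 \<in> \<Omega>" if "\<Omega> \<in> ?K" for \<Omega>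
    using K[OF that] zero_mem_weighted_cross_polytope by blast
  have lim_ex: "\<exists>g. \<forall>x. (\<lambda>n. infdist x (W n)) \<longlonglongrightarrow> g x"
    if "\<And>i. (\<lambda>n. F (W n) i) \<longlonglongrightarrow> l i" for W l
  proof -
    have "\<exists>m. (\<lambda>n. infdist d (W n)) \<longlonglongrightarrow> m" if "d \<in> D" for d
      using that \<open>\<And>i. (\<lambda>n. F (W n) i) \<longlonglongrightarrow> l i\<close> range_q unfolding F_def by blast
    then obtain m where "\<And>d. d \<in> D \<Longrightarrow> (\<lambda>n. infdist d (W n)) \<longlonglongrightarrow> m d"
      by metis
    then show ?thesis
      using infdist_pointwise_limit_of_dense[OF dense] by metis
  qed
  \<comment> \<open>The code is injective: values on a dense set determine the distance function,
    hence the closure, and an open convex set is the interior of its closure.\<close>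
  have eqF: "\<Omega> = \<Omega>'" if "\<Omega> \<in> ?K" "\<Omega>' \<in> ?K" "F \<Omega> = F \<Omega>'" for \<Omega> \<Omega>'
  proof -
    have "infdist x \<Omega> - infdist x \<Omega>' = 0" for x
    proof (rule continuous_constant_on_closure[of D])
      show "continuous_on (closure D) (\<lambda>x. infdist x \<Omega> - infdist x \<Omega>')"
        by (intro continuous_intros)
      fix d assume "d \<in> D"
      then obtain i where "d = q i"
        using range_q by blast
      then show "infdist d \<Omega> - infdist d \<Omega>' = 0"
        using fun_cong[OF that(3), of i] by (simp add: F_def)
    qed (use dense in auto)
    then have "closure \<Omega> = closure \<Omega>'"
      using in_closure_iff_infdist_zero zero that(1,2)
      by (metis (no_types, lifting) empty_iff eq_iff_diff_eq_0 subsetI subset_antisym)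
    then show ?thesis
      using K that(1,2) convex_interior_closure interior_open by metis
  qed
  \<comment> \<open>This gives both closedness of the set of codes and sequential continuity of
    decoding.\<close>
  have seq: "\<exists>\<Omega>\<in>?K. F \<Omega> = l \<and> local_hausdorff_tendsto W \<Omega>"
    if W: "\<And>n. W n \<in> ?K" and l: "(\<lambda>n. F (W n)) \<longlonglongrightarrow> l" for W l
  proof -
    obtain g where g: "\<And>x. (\<lambda>n. infdist x (W n)) \<longlonglongrightarrow> g x"
      using lim_ex[OF tendsto_fun_apply[OF l]] by blast
    obtain \<Omega> where \<Omega>: "\<Omega> \<in> ?K" "\<And>x. infdist x \<Omega> = g x"
      using normalized_domains_infdist_limit[OF assms(1) W g] by blast
    have "F \<Omega> i = l i" for i
      using LIMSEQ_unique[OF tendsto_fun_apply[OF l, of i]] g[of "q i"] \<Omega>(2) by (simp add: F_def)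
    moreover have "local_hausdorff_tendsto W \<Omega>"
      using K[OF W] K[OF \<Omega>(1)] zero W \<Omega> g by (intro local_hausdorff_tendsto_of_infdist) auto
    ultimately show ?thesis
      using \<Omega>(1) by blast
  qed
  have "compact (F ` ?K)"
    unfolding compact_eq_seq_compact_metric seq_compact_def
  proof (intro allI impI)
    fix f :: "nat \<Rightarrow> nat \<Rightarrow> real" assume "\<forall>n. f n \<in> F ` ?K"
    then have "\<forall>n. \<exists>\<Omega>. \<Omega> \<in> ?K \<and> f n = F \<Omega>"
      by blast
    then obtain W where W: "\<And>n. W n \<in> ?K" "\<And>n. f n = F (W n)"
      by metis
    \<comment> \<open>Every domain in \<open>?K\<close> contains 0, so its distance from
      \<open>q i\<close> is at most \<open>norm (q i)\<close>.\<close>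
    let ?B = "{f :: nat \<Rightarrow> real. \<forall>i. f i \<in> {0..norm (q i)}}"
    have "\<forall>n. f n \<in> ?B"
      using W(2) infdist_le[OF zero[OF W(1)]] by (simp add: F_def infdist_nonneg dist_norm)
    then obtain l s where s: "strict_mono s" "(f \<circ> s) \<longlonglongrightarrow> l"
      using compact_box_sequences unfolding compact_eq_seq_compact_metric seq_compact_def by metis
    then have "(\<lambda>n. F (W (s n))) \<longlonglongrightarrow> l"
      by (simp add: o_def W(2))
    then have "l \<in> F ` ?K"
      using seq[of "\<lambda>n. W (s n)" l] W(1) by blast
    with s show "\<exists>l\<in>F ` ?K. \<exists>s. strict_mono s \<and> (f \<circ> s) \<longlonglongrightarrow> l"
      by blast
  qed
  define G where "G = inv_into ?K F"
  have G: "G x \<in> ?K" "F (G x) = x" if "x \<in> F ` ?K" for x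
    using that by (auto simp: G_def inv_into_into f_inv_into_f)
  have GF: "G (F \<Omega>) = \<Omega>" if "\<Omega> \<in> ?K" for \<Omega>
    using eqF G[of "F \<Omega>"] that by blast
  have "continuous_map (top_of_set (F ` ?K)) local_hausdorff_topology G"
    unfolding continuous_map_def
  proof (intro conjI allI impI)
    have KX: "?K \<subseteq> C_properly_convex_domains"
      by (auto simp: normalized_domains_def)
    then show "G \<in> topspace (top_of_set (F ` ?K)) \<rightarrow> topspace local_hausdorff_topology"
      using G(1) by (auto simp: topspace_local_hausdorff_topology)
    fix U :: "((complex, 'n) vec) set set" assume "openin local_hausdorff_topology U"
    then have U: "local_hausdorff_open U"
      by (simp add: openin_local_hausdorff_topology)
    \<comment> \<open>The codes form a metric space, so if openness failed at \<open>x\<close>,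
      codes \<open>y n\<close> tending to \<open>x\<close> would decode outside \<open>U\<close>. By
      \<open>seq\<close> their decodings converge to \<open>G x \<in> U\<close>, contradicting the
      sequential definition of open sets.\<close>
    show "openin (top_of_set (F ` ?K)) {x \<in> topspace (top_of_set (F ` ?K)). G x \<in> U}"
      unfolding openin_euclidean_subtopology_iff
    proof (intro conjI ballI)
      fix x assume x: "x \<in> {x \<in> topspace (top_of_set (F ` ?K)). G x \<in> U}"
      show "\<exists>e>0. \<forall>x'\<in>F ` ?K. dist x' x < e \<longrightarrow> x' \<in> {x \<in> topspace (top_of_set (F ` ?K)). G x \<in> U}"
      proof (rule ccontr)
        assume neg: "\<not> ?thesis"
        have "\<exists>y. y \<in> F ` ?K \<and> dist y x < inverse (Suc n) \<and> G y \<notin> U" for n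
        proof -
          have "inverse (real (Suc n)) > 0" by simp
          then show ?thesis using neg by auto
        qed
        then obtain y where y: "\<And>n. y n \<in> F ` ?K" "\<And>n. dist (y n) x < inverse (Suc n)" "\<And>n. G (y n) \<notin> U"
          by metis
        have "y \<longlonglongrightarrow> x"
        proof (rule metric_tendsto_imp_tendsto[OF LIMSEQ_inverse_real_of_nat])
          show "\<forall>\<^sub>F n in sequentially. dist (y n) x \<le> dist (inverse (real (Suc n))) 0"
            using y(2) by (intro always_eventually allI less_imp_le) simp
        qed
        then have "(\<lambda>n. F (G (y n))) \<longlonglongrightarrow> x"
          using G(2) y(1) by simp
        then obtain \<Omega> where \<Omega>: "\<Omega> \<in> ?K" "F \<Omega> = x" "local_hausdorff_tendsto (\<lambda>n. G (y n)) \<Omega>"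
          using seq[of "\<lambda>n. G (y n)" x] G(1) y(1) by blast
        then have "\<Omega> \<in> U"
          using x GF[OF \<Omega>(1)] by simp
        moreover have "range (\<lambda>n. G (y n)) \<subseteq> C_properly_convex_domains"
          using G(1) y(1) KX by blast
        ultimately have "\<forall>\<^sub>F n in sequentially. G (y n) \<in> U"
          using U \<Omega>(3) unfolding local_hausdorff_open_def by blast
        then show False
          using y(3) by simp
      qed
    qed auto
  qed
  moreover have "compactin (top_of_set (F ` ?K)) (F ` ?K)"
    using \<open>compact (F ` ?K)\<close> by (simp add: compactin_subtopology)
  ultimately have "compactin local_hausdorff_topology (G ` F ` ?K)"
    using image_compactin by blast
  moreover have "G ` F ` ?K = ?K"
    using GF by (force simp: image_image)
  ultimately show ?thesis
    by simp
qed

end
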